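(* Let $C\subseteq\mathbb{F}_q^n$ be an $[n,k]$ code over $\mathbb{F}_q$, let $C^\perp$ be its dual code, let $T\subseteq[n]$, and let $r\ge 0$ be an integer. Then $$J_{C^{\perp},T}^{(r)}(w,z,x,y)=\sum_{j=0}^{r}\sum_{\ell=0}^{j}(-1)^{r-j}\,\frac{q^{\binom{r-j}{2}-j(r-j)-\ell(j-\ell)-jk}}{[r-j]_q\,[j-\ell]_q}\;J_{C,T}^{(\ell)}\bigl(w+(q^j-1)z,\;w-z,\;x+(q^j-1)y,\;x-y\bigr).$$
   Context: $q$ is a prime power, $\mathbb{F}_q$ the field with $q$ elements, $[n]=\{1,\dots,n\}$, and $\overline{T}=[n]\setminus T$. An $[n,k]$ code over $\mathbb{F}_q$ is a $k$-dimensional $\mathbb{F}_q$-linear subspace $C$ of $\mathbb{F}_q^n$; its dual is $C^\perp=\{u\in\mathbb{F}_q^n : \sum_i u_iv_i=0\ \text{for all } v\in C\}$. For a linear subspace $D\subseteq\mathbb{F}_q^n$, $\mathrm{Supp}(D)=\{i\in[n] : u_i\ne 0\text{ for some }u\in D\}$, and for $S\subseteq[n]$, $\mathrm{wt}_S(D)=|\mathrm{Supp}(D)\cap S|$. For an integer $r\ge 0$, $\mathcal{D}_r(C)$ is the set of $r$-dimensional $\mathbb{F}_q$-subspaces of $C$ (empty if $r>\dim C$). The $r$-th higher Jacobi polynomial of a linear code $C$ of length $n$ associated to $T$ is $$J_{C,T}^{(r)}(w,z,x,y)=\sum_{i=0}^{n-|T|}\sum_{j=0}^{|T|}A_{i,j}^{(r)}(C,T)\,w^{|T|-j}z^{j}x^{n-|T|-i}y^{i},$$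 where $A_{i,j}^{(r)}(C,T)=\#\{D\in\mathcal{D}_r(C) : \mathrm{wt}_{\overline{T}}(D)=i,\ \mathrm{wt}_T(D)=j\}$ (a polynomial in indeterminates $w,z,x,y$). For integers $a,b\ge0$: $[a,b]_q=\prod_{i=0}^{b-1}(q^a-q^i)$ and $[a]_q=[a,a]_q$ (so $[0]_q=1$). *)

theory Defs
  imports "HOL-Analysis.Cartesian_Space" "HOL-Library.Poly_Mapping"
begin

text \<open>The field with \<open>q\<close> elements is an arbitrary finite field type \<open>'a\<close> with
  \<open>q = CARD('a)\<close>, and the coordinate set is a finite type \<open>'n\<close> with \<open>n = CARD('n)\<close>.\<close>

definition linear_code :: "('a::field ^ 'n::finite) set \<Rightarrow> nat \<Rightarrow> bool" where
  "linear_code C k \<longleftrightarrow> vec.subspace C \<and> vec.dim C = k"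

definition dual_code :: "('a::field ^ 'n::finite) set \<Rightarrow> ('a ^ 'n) set" where
  "dual_code C = {u. \<forall>v\<in>C. (\<Sum>i\<in>UNIV. u $ i * v $ i) = 0}"

definition Supp :: "('a::field ^ 'n::finite) set \<Rightarrow> 'n set" where
  "Supp D = {i. \<exists>u\<in>D. u $ i \<noteq> 0}"

definition wt :: "'n::finite set \<Rightarrow> ('a::field ^ 'n) set \<Rightarrow> nat" where
  "wt S D = card (Supp D \<inter> S)"

definition subcodes :: "nat \<Rightarrow> ('a::field ^ 'n::finite) set \<Rightarrow> ('a ^ 'n) set set" where
  "subcodes r C = {D. vec.subspace D \<and> D \<subseteq> C \<and> vec.dim D = r}"

definition jacobi_coeff ::
    "nat \<Rightarrow> ('a::{field,finite} ^ 'n::finite) set \<Rightarrow> 'n set \<Rightarrow> nat \<Rightarrow> nat \<Rightarrow> nat" where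
  "jacobi_coeff r C T i j = card {D \<in> subcodes r C. wt (- T) D = i \<and> wt T D = j}"

text \<open>The four arguments range over any commutative ring. At the indeterminates of a polynomial
  ring the value is the higher Jacobi polynomial itself; at other elements of that ring it is the
  result of substituting them for the indeterminates.\<close>

definition higher_jacobi ::
    "nat \<Rightarrow> ('a::{field,finite} ^ 'n::finite) set \<Rightarrow> 'n set
      \<Rightarrow> 'b \<Rightarrow> 'b \<Rightarrow> 'b \<Rightarrow> 'b \<Rightarrow> 'b::comm_ring_1" where
  "higher_jacobi r C T w z x y =
     (\<Sum>i = 0..CARD('n) - card T. \<Sum>j = 0..card T.
        of_nat (jacobi_coeff r C T i j) * w ^ (card T - j) * z ^ j
          * x ^ (CARD('n) - card T - i) * y ^ i)"

text \<open>\<open>\<rat>[w,z,x,y]\<close>: a monomial is a finitely supported map from indeterminates to exponents, a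
  polynomial a finitely supported map from monomials to coefficients.\<close>

datatype indet = Ind_w | Ind_z | Ind_x | Ind_y

type_synonym rat_poly4 = "(indet \<Rightarrow>\<^sub>0 nat) \<Rightarrow>\<^sub>0 rat"

definition indeterminate :: "indet \<Rightarrow> rat_poly4" where
  "indeterminate v = Poly_Mapping.single (Poly_Mapping.single v 1) 1"

definition const_poly :: "rat \<Rightarrow> rat_poly4" where
  "const_poly c = Poly_Mapping.single 0 c"

text \<open>\<open>q_prod q a b\<close> is \<open>[a,b]\<^sub>q\<close>, and \<open>q_order q a\<close> is \<open>[a]\<^sub>q\<close>.\<close>

definition q_prod :: "rat \<Rightarrow> nat \<Rightarrow> nat \<Rightarrow> rat" where
  "q_prod q a b = (\<Prod>i<b. q ^ a - q ^ i)"

definition q_order :: "rat \<Rightarrow> nat \<Rightarrow> rat" where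
  "q_order q a = q_prod q a a"

end

theory Submission
  imports Defs
begin

text \<open>
  The identity can be checked one set of coordinates at a time. A subcode \<open>D\<close> contributes
  the product over all coordinates \<open>i\<close> of \<open>b\<^sub>i\<close> if \<open>i \<in> Supp D\<close> and of \<open>a\<^sub>i\<close> otherwise, where \<open>(a\<^sub>i, b\<^sub>i)\<close> is \<open>(w, z)\<close> on \<open>T\<close> and \<open>(x, y)\<close> off \<open>T\<close>.
  Writing \<open>a\<^sub>i = (a\<^sub>i - b\<^sub>i) + b\<^sub>i\<close> and multiplying out, a term indexed by a set \<open>S\<close> survives exactly
  when \<open>D\<close> vanishes on \<open>S\<close>. Hence the polynomial is the sum over all \<open>S\<close> of
  \<open>\<Prod>\<^sub>S (a\<^sub>i - b\<^sub>i) \<Prod>\<^bsub>-S\<^esub> b\<^sub>i\<close> times the number of \<open>r\<close>-dimensional subspaces of the shortened code \<open>C\<^sub>S\<close>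
  of words vanishing on \<open>S\<close> (\<open>higher_jacobi_eq_sum_shortened\<close>), and that number is the Gaussian
  binomial coefficient of \<open>dim C\<^sub>S\<close> and \<open>r\<close> (\<open>card_subcodes\<close>).

  The MacWilliams substitution replaces \<open>b\<^sub>i\<close> by \<open>a\<^sub>i - b\<^sub>i\<close> and \<open>a\<^sub>i - b\<^sub>i\<close> by \<open>q\<^sup>j b\<^sub>i\<close>. So it reproduces the
  same products with \<open>S\<close> and its complement exchanged, up to a power of \<open>q\<^sup>j\<close>
  (\<open>higher_jacobi_macwilliams_arguments\<close>). It remains to compare the coefficients of each product.
  The two dimensions involved are linked by
  \<open>dim (C\<^sup>\<bottom>)\<^sub>S + dim C = dim C\<^bsub>-S\<^esub> + |-S|\<close> (\<open>dim_shortened_dual\<close>), and what is left is an identity of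
  rational numbers (\<open>q_binomial_dual_transform\<close>). In it the sum over \<open>l\<close> expands a power of \<open>q\<close> in
  the products \<open>\<Prod>\<^bsub>i<l\<^esub> (X - q\<^sup>i)\<close>, and the sum over \<open>j\<close> is Cauchy's expansion of such a product in powers
  of \<open>X\<close>: the two are mutually inverse changes of basis.
\<close>

section \<open>Gaussian binomials\<close>

fun q_binomial :: "'b::comm_ring_1 \<Rightarrow> nat \<Rightarrow> nat \<Rightarrow> 'b" where
  "q_binomial q n 0 = 1"
| "q_binomial q 0 (Suc k) = 0"
| "q_binomial q (Suc n) (Suc k) = q_binomial q n k + q ^ Suc k * q_binomial q n (Suc k)"

lemma q_binomial_eq_0: "n < k \<Longrightarrow> q_binomial q n k = 0"
  by (induction q n k rule: q_binomial.induct) auto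

text \<open>The index shift that turns the Pascal recursion into a sum of two full sums; it serves both
  \<open>q\<close>-binomial theorems below.\<close>
lemma sum_pascal:
  fixes f g :: "nat \<Rightarrow> 'b::comm_ring_1"
  assumes "g (Suc n) = 0"
  shows "g 0 + (\<Sum>k\<le>n. f k + g (Suc k)) = (\<Sum>k\<le>n. f k) + (\<Sum>k\<le>n. g k)"
proof -
  have "g 0 + (\<Sum>k\<le>n. g (Suc k)) = (\<Sum>k\<le>Suc n. g k)"
    by (simp only: sum.atMost_Suc_shift)
  then show ?thesis
    using assms by (simp add: sum.distrib algebra_simps)
qed

text \<open>Multiplying the product with \<open>k\<close> factors by \<open>X = (X - q\<^sup>k) + q\<^sup>k\<close> gives the next product plus \<open>q\<^sup>k\<close> times
  the same one, which is the Pascal recursion of the coefficients.\<close>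
lemma power_eq_sum_q_binomial:
  fixes q X :: "'b::comm_ring_1"
  shows "X ^ n = (\<Sum>k\<le>n. q_binomial q n k * (\<Prod>i<k. X - q ^ i))"
proof (induction n)
  case (Suc n)
  let ?P = "\<lambda>k. \<Prod>i<k. X - q ^ i"
  let ?g = "\<lambda>k. q ^ k * q_binomial q n k * ?P k"
  have "(\<Sum>k\<le>Suc n. q_binomial q (Suc n) k * ?P k)
      = ?g 0 + (\<Sum>k\<le>n. q_binomial q n k * ?P (Suc k) + ?g (Suc k))"
    by (simp only: sum.atMost_Suc_shift) (simp add: algebra_simps)
  also have "\<dots> = (\<Sum>k\<le>n. q_binomial q n k * ?P (Suc k)) + (\<Sum>k\<le>n. ?g k)"
    by (rule sum_pascal) (simp add: q_binomial_eq_0)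
  also have "\<dots> = X * (\<Sum>k\<le>n. q_binomial q n k * ?P k)"
    by (simp add: sum.distrib[symmetric] sum_distrib_left algebra_simps)
  finally show ?case
    using Suc.IH by simp
qed simp

text \<open>The inverse expansion. Multiplying by the new factor \<open>X - q\<^sup>n\<close> again produces the Pascal recursion,
  because \<open>q\<^sup>n\<close> times \<open>q\<close> to the power \<open>m choose 2\<close>, with \<open>m = n - k\<close>, is \<open>q\<^sup>k\<close> times \<open>q\<close> to the power
  \<open>Suc m choose 2\<close>.\<close>
lemma cauchy_q_binomial:
  fixes q X :: "'b::comm_ring_1"
  shows "(\<Prod>i<n. X - q ^ i)
    = (\<Sum>k\<le>n. (- 1) ^ (n - k) * q ^ ((n - k) choose 2) * q_binomial q n k * X ^ k)"
proof (induction n)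
  case (Suc n)
  let ?s = "\<lambda>m. (- 1) ^ m * q ^ (m choose 2)"
  let ?f = "\<lambda>k. ?s (n - k) * q_binomial q n k * X ^ Suc k"
  let ?g = "\<lambda>k. ?s (Suc n - k) * (q ^ k * q_binomial q n k) * X ^ k"
  have g: "?g k = - (q ^ n) * (?s (n - k) * q_binomial q n k * X ^ k)" if "k \<le> n" for k
  proof -
    from le_Suc_ex[OF that] obtain m where n: "n = k + m" ..
    have "Suc m choose 2 = m + (m choose 2)"
      using binomial_Suc_Suc[of m 1] by (simp flip: numeral_2_eq_2)
    then show ?thesis
      by (simp add: n power_add algebra_simps)
  qed
  have "(\<Sum>k\<le>Suc n. ?s (Suc n - k) * q_binomial q (Suc n) k * X ^ k)
      = ?g 0 + (\<Sum>k\<le>n. ?f k + ?g (Suc k))"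
    by (simp only: sum.atMost_Suc_shift) (simp add: algebra_simps)
  also have "\<dots> = (\<Sum>k\<le>n. ?f k) + (\<Sum>k\<le>n. ?g k)"
    by (rule sum_pascal) (simp add: q_binomial_eq_0)
  also have "(\<Sum>k\<le>n. ?g k)
      = - (q ^ n) * (\<Sum>k\<le>n. ?s (n - k) * q_binomial q n k * X ^ k)"
    unfolding sum_distrib_left by (intro sum.cong refl g) simp
  also have "(\<Sum>k\<le>n. ?f k) = X * (\<Sum>k\<le>n. ?s (n - k) * q_binomial q n k * X ^ k)"
    by (simp add: sum_distrib_left algebra_simps)
  finally show ?case
    unfolding prod.lessThan_Suc Suc.IH by (simp add: algebra_simps)
qed (simp add: binomial_eq_0)

lemma q_prod_Suc_Suc: "q_prod q (Suc a) (Suc b) = (q ^ Suc a - 1) * q ^ b * q_prod q a b"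
proof -
  have "q_prod q (Suc a) (Suc b) = (q ^ Suc a - 1) * (\<Prod>i<b. q * (q ^ a - q ^ i))"
    unfolding q_prod_def prod.lessThan_Suc_shift by (simp add: algebra_simps)
  then show ?thesis
    by (simp add: q_prod_def prod.distrib)
qed

text \<open>The Gaussian binomial is the number of independent \<open>k\<close>-tuples of an \<open>n\<close>-dimensional space over a field
  with \<open>q\<close> elements, divided by the number of ordered bases of a \<open>k\<close>-dimensional one; the proof compares the Pascal recursions.\<close>
lemma q_prod_eq_q_binomial: "q_prod q n k = q_binomial q n k * q_order q k"
proof (induction q n k rule: q_binomial.induct)
  case (1 q n)
  then show ?case by (simp add: q_order_def q_prod_def)
next
  case (2 q k)
  show ?case unfolding q_prod_def prod.lessThan_Suc_shift by simp
next
  case (3 q n k)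
  have step: "q_prod q n (Suc k) = q_prod q n k * (q ^ n - q ^ k)"
    by (simp add: q_prod_def)
  have "q_binomial q (Suc n) (Suc k) * q_order q (Suc k)
      = (q ^ Suc k - 1) * q ^ k * (q_binomial q n k * q_order q k)
        + q ^ Suc k * (q_binomial q n (Suc k) * q_order q (Suc k))"
    by (simp add: q_order_def q_prod_Suc_Suc algebra_simps)
  also have "\<dots> = (q ^ Suc k - 1) * q ^ k * q_prod q n k + q ^ Suc k * q_prod q n (Suc k)"
    by (simp only: 3)
  also have "\<dots> = q_prod q (Suc n) (Suc k)"
    unfolding step q_prod_Suc_Suc by (simp add: algebra_simps)
  finally show ?case ..
qed

lemma q_order_nonzero: "1 < q \<Longrightarrow> q_order q n \<noteq> 0"
  by (auto simp: q_order_def q_prod_def power_inject_exp)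

text \<open>An ordered basis is an independent \<open>l\<close>-tuple followed by \<open>m\<close> further vectors; pulling \<open>q\<^sup>l\<close> out of each
  of the last \<open>m\<close> factors leaves the number of ordered bases of the quotient.\<close>
lemma q_order_split:
  "q_order q (l + m) = q_prod q (l + m) l * (q ^ (l * m) * q_order q m)"
proof -
  have split: "(\<Prod>i<l + m. f i) = (\<Prod>i<l. f i) * (\<Prod>i<m. f (l + i))" for f :: "nat \<Rightarrow> rat"
    by (induction m) (simp_all add: mult.assoc)
  have "(\<Prod>i<l + m. q ^ (l + m) - q ^ i)
      = (\<Prod>i<l. q ^ (l + m) - q ^ i) * (\<Prod>i<m. q ^ (l + m) - q ^ (l + i))"
    by (rule split)
  also have "(\<Prod>i<m. q ^ (l + m) - q ^ (l + i)) = (\<Prod>i<m. q ^ l * (q ^ m - q ^ i))"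
    by (simp add: power_add right_diff_distrib)
  finally show ?thesis
    by (simp add: q_order_def q_prod_def prod.distrib power_mult)
qed

lemma q_order_eq_q_binomial:
  "q_order q (l + m) = q_binomial q (l + m) l * q_order q l * q ^ (l * m) * q_order q m"
  by (simp add: q_order_split[of q l m] q_prod_eq_q_binomial)

text \<open>The coefficient identity. After the denominators are absorbed, the sum over \<open>l\<close> is the expansion of
  the \<open>j\<close>-th power of \<open>q\<^sup>d\<close>. With \<open>d + m - k = d'\<close> the sum over \<open>j\<close> then becomes Cauchy's expansion at
  \<open>X = q\<close> to the power \<open>d'\<close>, divided by the number of ordered bases of an \<open>r\<close>-dimensional space.\<close>
lemma q_binomial_dual_transform:
  fixes q :: rat
  assumes q: "1 < q" and d: "d' + k = d + m"
  shows "q_binomial q d' r = (\<Sum>j = 0..r. \<Sum>l = 0..j.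
      ((- 1) ^ (r - j)
        * (q powi (int ((r - j) choose 2) - int (j * (r - j)) - int (l * (j - l)) - int (j * k))
            / (q_order q (r - j) * q_order q (j - l))))
      * (q ^ j) ^ m * q_binomial q d l)"
    (is "_ = (\<Sum>j = 0..r. \<Sum>l = 0..j. ?c j l * (q ^ j) ^ m * _)")
proof -
  note nz = q_order_nonzero[OF q]
  have q0: "q \<noteq> 0"
    using q by simp
  have inner: "(\<Sum>l = 0..j. ?c j l * (q ^ j) ^ m * q_binomial q d l)
      = (- 1) ^ (r - j) * q ^ ((r - j) choose 2) * q_binomial q r j * (q ^ d') ^ j / q_order q r"
    if "j \<le> r" for j
  proof -
    from le_Suc_ex[OF that] obtain s where r: "r = j + s" ..
    \<comment> \<open>The part of the summand that does not depend on \<open>l\<close>.\<close>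
    define K where "K = (- 1) ^ s * q ^ (s choose 2) * (q ^ j) ^ m
      / (q ^ (j * s) * q ^ (j * k) * q_order q s * q_order q j)"
    have "?c j l * (q ^ j) ^ m * q_binomial q d l = K * (q_binomial q j l * (\<Prod>i<l. q ^ d - q ^ i))"
      if "l \<le> j" for l
    proof -
      from le_Suc_ex[OF that] obtain t where j: "j = l + t" ..
      have "q_binomial q j l * (\<Prod>i<l. q ^ d - q ^ i)
          = q_binomial q j l * q_order q l * q_binomial q d l"
        using q_prod_eq_q_binomial[of q d l] by (simp add: q_prod_def)
      also have "\<dots> = q_order q j / (q ^ (l * t) * q_order q t) * q_binomial q d l"
        using q_order_eq_q_binomial[of q l t] nz[of t] q0 by (simp add: j)
      finally have G: "q_binomial q j l * (\<Prod>i<l. q ^ d - q ^ i)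
          = q_order q j / (q ^ (l * t) * q_order q t) * q_binomial q d l" .
      have "q powi (int (s choose 2) - int (j * s) - int (l * t) - int (j * k))
          = q ^ (s choose 2) / q ^ (j * s) / q ^ (l * t) / q ^ (j * k)"
        using q0 by (simp only: power_int_diff power_int_of_nat simp_thms)
      then have c: "?c j l = (- 1) ^ s * (q ^ (s choose 2) / q ^ (j * s) / q ^ (l * t) / q ^ (j * k)
          / (q_order q s * q_order q t))"
        by (simp only: r j add_diff_cancel_left')
      show ?thesis
        unfolding c G K_def using nz[of j] by (simp add: mult_ac)
    qed
    then have "(\<Sum>l = 0..j. ?c j l * (q ^ j) ^ m * q_binomial q d l)
        = K * (\<Sum>l\<le>j. q_binomial q j l * (\<Prod>i<l. q ^ d - q ^ i))"
      unfolding sum_distrib_left atLeast0AtMost by (intro sum.cong) auto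
    also have "\<dots> = K * (q ^ d) ^ j"
      by (simp only: power_eq_sum_q_binomial[symmetric])
    also have "\<dots> = (- 1) ^ s * q ^ (s choose 2) * ((q ^ d) ^ j * (q ^ j) ^ m)
        / (q ^ (j * s) * q ^ (j * k) * q_order q s * q_order q j)"
      by (simp add: K_def)
    also have "(q ^ d) ^ j * (q ^ j) ^ m = (q ^ d') ^ j * q ^ (j * k)"
    proof -
      have "d * j + j * m = d' * j + j * k"
        by (metis d add_mult_distrib mult.commute)
      then show ?thesis
        by (simp only: power_mult[symmetric] power_add[symmetric])
    qed
    also have "(- 1) ^ s * q ^ (s choose 2) * ((q ^ d') ^ j * q ^ (j * k))
        / (q ^ (j * s) * q ^ (j * k) * q_order q s * q_order q j)
      = (- 1) ^ s * q ^ (s choose 2) * (q ^ d') ^ j * (1 / (q ^ (j * s) * q_order q s * q_order q j))"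
      using q0 by simp
    also have "1 / (q ^ (j * s) * q_order q s * q_order q j) = q_binomial q r j / q_order q r"
      using q_order_eq_q_binomial[of q j s] nz[of j] nz[of s] nz[of "j + s"] q0
      by (simp add: r field_simps)
    finally show ?thesis
      by (simp add: r)
  qed
  have "q_binomial q d' r = (\<Prod>i<r. q ^ d' - q ^ i) / q_order q r"
    using q_prod_eq_q_binomial[of q d' r] nz[of r] by (simp add: q_prod_def field_simps)
  also have "\<dots> = (\<Sum>j = 0..r. (- 1) ^ (r - j) * q ^ ((r - j) choose 2) * q_binomial q r j
      * (q ^ d') ^ j / q_order q r)"
    unfolding cauchy_q_binomial sum_divide_distrib atLeast0AtMost ..
  also have "\<dots> = (\<Sum>j = 0..r. \<Sum>l = 0..j. ?c j l * (q ^ j) ^ m * q_binomial q d l)"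
    by (intro sum.cong refl inner[symmetric]) simp
  finally show ?thesis .
qed

section \<open>Counting subspaces over a finite field\<close>

lemma card_standard_subspace:
  "card {x :: 'a::{field,finite} ^ 'n::finite. \<forall>i. i \<notin> d \<longrightarrow> x $ i = 0} = CARD('a) ^ card d"
proof -
  have "bij_betw (\<lambda>f. \<chi> i. if i \<in> d then f i else 0) (d \<rightarrow>\<^sub>E UNIV)
      {x :: 'a ^ 'n. \<forall>i. i \<notin> d \<longrightarrow> x $ i = 0}"
    by (rule bij_betwI[where g = "\<lambda>x. restrict (($) x) d"])
      (auto simp: vec_eq_iff restrict_def PiE_def extensional_def)
  then have "card {x :: 'a ^ 'n. \<forall>i. i \<notin> d \<longrightarrow> x $ i = 0} = card (d \<rightarrow>\<^sub>E (UNIV :: 'a set))"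
    by (simp add: bij_betw_same_card)
  then show ?thesis
    by (simp add: card_PiE)
qed

lemma subspace_standard: "vec.subspace {x :: 'a::field ^ 'n::finite. \<forall>i. i \<notin> d \<longrightarrow> x $ i = 0}"
  by (auto simp: vec.subspace_def)

lemma card_field_gt_1: "1 < (of_nat CARD('a::{field,finite}) :: rat)"
proof -
  have "card {0, 1 :: 'a} \<le> CARD('a)"
    by (rule card_mono) auto
  then show ?thesis
    by simp
qed

text \<open>Every subspace is isomorphic to a coordinate subspace, whose elements can be counted directly.\<close>
lemma card_subspace:
  fixes V :: "('a::{field,finite} ^ 'n::finite) set"
  assumes "vec.subspace V"
  shows "card V = CARD('a) ^ vec.dim V"
proof -
  have "vec.dim V \<le> card (UNIV :: 'n set)"
    by (rule dim_subset_UNIV_cart_gen)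
  then obtain d :: "'n set" where d: "card d = vec.dim V"
    by (meson obtain_subset_with_card_n)
  have "\<exists>f. Vector_Spaces.linear (*s) (*s) f
      \<and> f ` V = {x :: 'a ^ 'n. \<forall>i. i \<notin> d \<longrightarrow> x $ i = 0} \<and> inj_on f V"
    by (rule vec.subspace_isomorphism[OF assms subspace_standard])
      (simp add: dim_substandard_cart d)
  then obtain f where "f ` V = {x :: 'a ^ 'n. \<forall>i. i \<notin> d \<longrightarrow> x $ i = 0}" and "inj_on f V"
    by blast
  then show ?thesis
    using card_image[of f V] by (simp add: card_standard_subspace d)
qed

text \<open>Ordered tuples rather than sets: they can be counted by prepending one vector at a time, and the
  tuples spanning a given subspace are its ordered bases.\<close>
definition independent_lists :: "nat \<Rightarrow> ('a::field ^ 'n::finite) set \<Rightarrow> ('a ^ 'n) list set" where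
  "independent_lists r V =
    {xs. length xs = r \<and> distinct xs \<and> vec.independent (set xs) \<and> set xs \<subseteq> V}"

lemma finite_independent_lists:
  "finite (independent_lists r (V :: ('a::{field,finite} ^ 'n::finite) set))"
  by (rule finite_subset[OF _ finite_lists_length_eq[of UNIV r]])
    (auto simp: independent_lists_def)

lemma Cons_in_independent_lists:
  "v # xs \<in> independent_lists (Suc r) V
    \<longleftrightarrow> xs \<in> independent_lists r V \<and> v \<in> V - vec.span (set xs)"
proof (cases "v \<in> set xs")
  case True
  then have "v \<in> vec.span (set xs)"
    by (rule vec.span_base)
  with True show ?thesis
    by (simp add: independent_lists_def)
next
  case False
  then have "vec.independent (insert v (set xs))
      \<longleftrightarrow> vec.independent (set xs) \<and> v \<notin> vec.span (set xs)"
    by (simp only: vec.independent_insert if_False)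
  with False show ?thesis
    by (simp add: independent_lists_def) blast
qed

lemma independent_lists_Suc:
  "independent_lists (Suc r) V
    = (\<lambda>(xs, v). v # xs) ` (SIGMA xs : independent_lists r V. V - vec.span (set xs))"
proof (intro set_eqI iffI)
  fix ys
  assume ys: "ys \<in> independent_lists (Suc r) V"
  then obtain v xs where "ys = v # xs"
    by (cases ys) (simp_all add: independent_lists_def)
  with ys show "ys \<in> (\<lambda>(xs, v). v # xs)
      ` (SIGMA xs : independent_lists r V. V - vec.span (set xs))"
    by (intro image_eqI[of _ _ "(xs, v)"]) (simp_all add: Cons_in_independent_lists)
qed (clarsimp simp: Cons_in_independent_lists)

text \<open>A tuple of \<open>r\<close> independent vectors extends by any vector of \<open>V\<close> outside its span, and the span has
  \<open>q\<^sup>r\<close> elements. If \<open>r\<close> exceeds \<open>dim V\<close>, both sides vanish.\<close>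
lemma card_independent_lists:
  fixes V :: "('a::{field,finite} ^ 'n::finite) set"
  assumes V: "vec.subspace V"
  shows "of_nat (card (independent_lists r V)) = q_prod (of_nat CARD('a)) (vec.dim V) r"
proof (induction r)
  case 0
  have "independent_lists 0 V = {[]}"
    by (auto simp: independent_lists_def vec.independent_empty)
  then show ?case
    by (simp add: q_prod_def)
next
  case (Suc r)
  let ?q = "of_nat CARD('a) :: rat"
  have ext: "of_nat (card (V - vec.span (set xs))) = ?q ^ vec.dim V - ?q ^ r"
    if "xs \<in> independent_lists r V" for xs
  proof -
    from that have "vec.dim (vec.span (set xs)) = r"
      by (simp add: independent_lists_def vec.dim_span_eq_card_independent distinct_card
        del: vec.dim_span)
    then have span: "card (vec.span (set xs)) = CARD('a) ^ r"
      by (simp add: card_subspace)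
    have sub: "vec.span (set xs) \<subseteq> V"
      using that V by (intro vec.span_minimal) (simp_all add: independent_lists_def)
    then have "card (vec.span (set xs)) \<le> card V"
      by (intro card_mono) auto
    then show ?thesis
      using card_Diff_subset[OF _ sub] by (simp only: of_nat_diff finite span card_subspace[OF V] of_nat_power simp_thms)
  qed
  have "card (independent_lists (Suc r) V)
      = card (SIGMA xs : independent_lists r V. V - vec.span (set xs))"
    unfolding independent_lists_Suc by (rule card_image) (auto simp: inj_on_def)
  also have "\<dots> = (\<Sum>xs\<in>independent_lists r V. card (V - vec.span (set xs)))"
    by (rule card_SigmaI) (simp_all add: finite_independent_lists)
  finally have "(of_nat (card (independent_lists (Suc r) V)) :: rat)
      = (\<Sum>xs\<in>independent_lists r V. of_nat (card (V - vec.span (set xs))))"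
    by simp
  also have "\<dots> = of_nat (card (independent_lists r V)) * (?q ^ vec.dim V - ?q ^ r)"
    by (simp only: ext sum_constant cong: sum.cong)
  finally show ?case
    by (simp only: Suc.IH q_prod_def prod.lessThan_Suc)
qed

lemma independent_lists_eq_UN_subcodes:
  fixes V :: "('a::field ^ 'n::finite) set"
  assumes V: "vec.subspace V"
  shows "independent_lists r V = (\<Union>D\<in>subcodes r V. independent_lists r D)"
proof (intro set_eqI iffI)
  fix xs
  assume xs: "xs \<in> independent_lists r V"
  then have "vec.span (set xs) \<in> subcodes r V"
    using V by (simp add: independent_lists_def subcodes_def vec.dim_span_eq_card_independent
        distinct_card vec.span_minimal del: vec.dim_span)
  moreover have "xs \<in> independent_lists r (vec.span (set xs))"
    using xs by (auto simp: independent_lists_def vec.span_base)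
  ultimately show "xs \<in> (\<Union>D\<in>subcodes r V. independent_lists r D)"
    by blast
qed (auto simp: independent_lists_def subcodes_def)

lemma span_independent_list:
  assumes "D \<in> subcodes r V" and "xs \<in> independent_lists r D"
  shows "vec.span (set xs) = D"
proof (rule vec.subspace_dim_equal)
  show "vec.subspace D" "vec.span (set xs) \<subseteq> D"
    using assms by (simp_all add: subcodes_def independent_lists_def vec.span_minimal)
  show "vec.dim D \<le> vec.dim (vec.span (set xs))"
    using assms by (simp add: subcodes_def independent_lists_def
        vec.dim_span_eq_card_independent distinct_card del: vec.dim_span)
qed simp

text \<open>Sorting the independent \<open>r\<close>-tuples by their span gives each subspace as often as it has ordered
  bases.\<close>
lemma card_subcodes:
  fixes V :: "('a::{field,finite} ^ 'n::finite) set"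
  assumes V: "vec.subspace V"
  shows "of_nat (card (subcodes r V)) = q_binomial (of_nat CARD('a) :: rat) (vec.dim V) r"
proof -
  let ?q = "of_nat CARD('a) :: rat"
  have q: "1 < ?q"
    by (rule card_field_gt_1)
  have fin: "finite (subcodes r V)"
    by (rule finite_subset[of _ "Pow UNIV"]) auto
  have "card (independent_lists r V) = (\<Sum>D\<in>subcodes r V. card (independent_lists r D))"
    unfolding independent_lists_eq_UN_subcodes[OF V]
  proof (intro card_UN_disjoint ballI impI fin finite_independent_lists)
    fix D E
    assume "D \<in> subcodes r V" "E \<in> subcodes r V" "D \<noteq> E"
    then show "independent_lists r D \<inter> independent_lists r E = {}"
      by (metis disjoint_iff span_independent_list)
  qed
  then have "q_prod ?q (vec.dim V) r = (\<Sum>D\<in>subcodes r V. of_nat (card (independent_lists r D)))"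
    by (simp add: card_independent_lists[OF V, symmetric])
  also have "\<dots> = of_nat (card (subcodes r V)) * q_order ?q r"
    by (simp add: subcodes_def card_independent_lists q_order_def)
  finally have "q_binomial ?q (vec.dim V) r * q_order ?q r
      = of_nat (card (subcodes r V)) * q_order ?q r"
    by (simp only: q_prod_eq_q_binomial)
  then show ?thesis
    using q_order_nonzero[OF q, of r] by (metis mult_right_cancel)
qed

section \<open>Shortened codes and duality\<close>

definition shortened :: "'n set \<Rightarrow> ('a::field ^ 'n::finite) set \<Rightarrow> ('a ^ 'n) set" where
  "shortened S C = {v \<in> C. \<forall>i\<in>S. v $ i = 0}"

lemma subspace_shortened: "vec.subspace C \<Longrightarrow> vec.subspace (shortened S C)"
  by (auto simp: vec.subspace_def shortened_def)

lemma subspace_dual_code: "vec.subspace (dual_code C)"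
  by (auto simp: vec.subspace_def dual_code_def distrib_right sum.distrib mult.assoc
      simp flip: sum_distrib_left)

lemma dual_code_span: "dual_code (vec.span B) = dual_code B"
proof
  show "dual_code (vec.span B) \<subseteq> dual_code B"
    by (auto simp: dual_code_def vec.span_base)
  show "dual_code B \<subseteq> dual_code (vec.span B)"
  proof
    fix u
    assume "u \<in> dual_code B"
    then have "B \<subseteq> dual_code {u}"
      by (auto simp: dual_code_def mult.commute)
    then have "vec.span B \<subseteq> dual_code {u}"
      by (intro vec.span_minimal subspace_dual_code)
    then show "u \<in> dual_code (vec.span B)"
      by (auto simp: dual_code_def mult.commute)
  qed
qed

text \<open>Extend a basis \<open>B\<close> of \<open>C\<close> to a basis of the whole space and take it as the rows of a matrix \<open>A\<close>. A
  vector orthogonal to all rows is zero, so \<open>A\<close> is invertible, and it maps the dual code onto the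
  coordinate subspace of vectors that vanish at the rows from \<open>B\<close>.\<close>
lemma dim_dual_code:
  fixes C :: "('a::field ^ 'n::finite) set"
  assumes C: "vec.subspace C"
  shows "vec.dim (dual_code C) + vec.dim C = CARD('n)"
proof -
  obtain B where B: "B \<subseteq> C" "vec.independent B" "C \<subseteq> vec.span B" "card B = vec.dim C"
    using vec.basis_exists by blast
  then have spanB: "vec.span B = C"
    using C by (metis vec.span_subspace)
  obtain B' where B': "B \<subseteq> B'" "vec.independent B'" "UNIV \<subseteq> vec.span B'"
    using vec.maximal_independent_subset_extend[of B UNIV] B(2) by auto
  have "finite B'"
    using B'(2) vec.finiteI_independent by blast
  moreover have "card B' = CARD('n)"
    using vec.basis_card_eq_dim[of B' UNIV] B' by (simp add: vec_dim_card del: vec.dim_UNIV)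
  ultimately obtain \<beta> where \<beta>: "bij_betw \<beta> (UNIV :: 'n set) B'"
    using finite_same_card_bij[of "UNIV :: 'n set" B'] by auto
  define A :: "'a ^ 'n ^ 'n" where "A = (\<chi> i. \<beta> i)"
  have A: "(A *v u) $ i = (\<Sum>j\<in>UNIV. u $ j * \<beta> i $ j)" for u i
    by (simp add: A_def matrix_vector_mult_def mult.commute)
  have "u = 0" if "A *v u = 0" for u
  proof -
    have "(\<Sum>j\<in>UNIV. u $ j * \<beta> i $ j) = 0" for i
      using that by (simp flip: A)
    then have "u \<in> dual_code B'"
      using \<beta> by (auto simp: dual_code_def bij_betw_def)
    then have "u \<in> dual_code UNIV"
      using B'(3) dual_code_span[of B'] by (simp add: top.extremum_unique)
    then have "(\<Sum>j\<in>UNIV. u $ j * axis i 1 $ j) = 0" for i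
      by (simp add: dual_code_def)
    then show "u = 0"
      by (simp add: vec_eq_iff axis_def if_distrib cong: if_cong)
  qed
  then have inj: "inj ((*v) A)"
    using matrix_left_invertible_injective matrix_left_invertible_ker by blast
  then have surj: "surj ((*v) A)"
    using vec.linear_injective_imp_surjective matrix_vector_mul_linear_gen by blast
  let ?d = "{i. \<beta> i \<notin> B}"
  have "(*v) A ` dual_code C = {x. \<forall>i. i \<notin> ?d \<longrightarrow> x $ i = 0}"
  proof -
    have "u \<in> dual_code C \<longleftrightarrow> (\<forall>i. i \<notin> ?d \<longrightarrow> (A *v u) $ i = 0)" for u
    proof -
      have "\<beta> ` {i. \<beta> i \<in> B} = B"
        using \<beta> B'(1) by (auto simp: bij_betw_def)
      then have "u \<in> dual_code B
          \<longleftrightarrow> (\<forall>v\<in>\<beta> ` {i. \<beta> i \<in> B}. (\<Sum>j\<in>UNIV. u $ j * v $ j) = 0)"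
        by (simp add: dual_code_def)
      then have "u \<in> dual_code B \<longleftrightarrow> (\<forall>i. i \<notin> ?d \<longrightarrow> (A *v u) $ i = 0)"
        by (simp add: A)
      then show ?thesis
        using dual_code_span[of B] spanB by simp
    qed
    then show ?thesis
      using surj by (auto simp: surj_def) (metis image_eqI)
  qed
  then have "vec.dim (dual_code C) = card ?d"
    using vec.dim_image_eq[OF matrix_vector_mul_linear_gen inj_on_subset[OF inj subset_UNIV],
        of "dual_code C"]
    by (simp only: dim_substandard_cart)
  moreover have "card {i. \<beta> i \<in> B} = card B"
  proof -
    have "\<beta> ` {i. \<beta> i \<in> B} = B"
      using \<beta> B'(1) by (auto simp: bij_betw_def)
    moreover have "inj_on \<beta> {i. \<beta> i \<in> B}"
      using \<beta> by (auto simp: bij_betw_def inj_on_def)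
    ultimately show ?thesis
      using card_image by metis
  qed
  moreover have "card ?d + card {i. \<beta> i \<in> B} = CARD('n)"
    by (subst card_Un_disjoint[symmetric]) (auto intro: arg_cong[of _ _ card])
  ultimately show ?thesis
    using B(4) by simp
qed

text \<open>Shortening the dual code at \<open>S\<close> imposes orthogonality to the space \<open>E\<close> of all vectors supported in \<open>S\<close>,
  so it yields the dual of \<open>C + E\<close>. The intersection of \<open>C\<close> and \<open>E\<close> is \<open>C\<close> shortened at the complement
  of \<open>S\<close>, and the dimension formula for sums finishes the count.\<close>
lemma dim_shortened_dual:
  fixes C :: "('a::field ^ 'n::finite) set"
  assumes C: "vec.subspace C"
  shows "vec.dim (shortened S (dual_code C)) + vec.dim C
    = vec.dim (shortened (- S) C) + card (- S)"
proof -
  let ?E = "{x :: 'a ^ 'n. \<forall>i. i \<notin> S \<longrightarrow> x $ i = 0}"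
  let ?CE = "{u + v | u v. u \<in> C \<and> v \<in> ?E}"
  have "shortened S (dual_code C) = dual_code ?CE"
  proof
    show "shortened S (dual_code C) \<subseteq> dual_code ?CE"
    proof
      fix u
      assume u: "u \<in> shortened S (dual_code C)"
      have "(\<Sum>i\<in>UNIV. u $ i * (v + e) $ i) = 0" if "v \<in> C" and "e \<in> ?E" for v e
      proof -
        have "u $ i * e $ i = 0" for i
          using u that(2) by (cases "i \<in> S") (simp_all add: shortened_def)
        then have "(\<Sum>i\<in>UNIV. u $ i * e $ i) = 0"
          by (intro sum.neutral ballI)
        then show ?thesis
          using u that(1) by (simp add: shortened_def dual_code_def distrib_left sum.distrib)
      qed
      then show "u \<in> dual_code ?CE"
        by (auto simp: dual_code_def)
    qed
    show "dual_code ?CE \<subseteq> shortened S (dual_code C)"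
    proof
      fix u
      assume u: "u \<in> dual_code ?CE"
      have "v \<in> ?CE" if "v \<in> C" for v
        using that by (intro CollectI exI[of _ v] exI[of _ 0]) simp
      then have "u \<in> dual_code C"
        using u by (simp add: dual_code_def)
      moreover have "u $ i = 0" if "i \<in> S" for i
      proof -
        have "axis i 1 \<in> ?CE"
          using that vec.subspace_0[OF C]
          by (intro CollectI exI[of _ 0] exI[of _ "axis i 1"]) (auto simp: axis_def)
        then have "(\<Sum>j\<in>UNIV. u $ j * axis i 1 $ j) = 0"
          using u unfolding dual_code_def by blast
        then show ?thesis
          by (simp add: axis_def if_distrib cong: if_cong)
      qed
      ultimately show "u \<in> shortened S (dual_code C)"
        by (simp add: shortened_def)
    qed
  qed
  moreover have "vec.dim (dual_code ?CE) + vec.dim ?CE = CARD('n)"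
    by (intro dim_dual_code vec.subspace_sums C subspace_standard)
  moreover have "vec.dim ?CE + vec.dim (C \<inter> ?E) = vec.dim C + card S"
    using vec.dim_sums_Int[OF C subspace_standard[of S]] by (simp add: dim_substandard_cart)
  moreover have "C \<inter> ?E = shortened (- S) C"
    by (auto simp: shortened_def)
  moreover have "card S + card (- S) = CARD('n)"
    by (metis card_Un_disjoint Compl_disjoint Compl_partition finite)
  ultimately show ?thesis
    by simp
qed

section \<open>Higher Jacobi polynomials\<close>

text \<open>Grouping the subcodes by their pair of weights recovers the definition; written coordinate by
  coordinate, the monomial of a subcode becomes a product that can be expanded.\<close>
lemma higher_jacobi_eq_sum_subcodes:
  fixes C :: "('a::{field,finite} ^ 'n::finite) set" and w z x y :: "'b::comm_ring_1"
  shows "higher_jacobi r C T w z x y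
    = (\<Sum>D\<in>subcodes r C. \<Prod>i\<in>UNIV.
        if i \<in> Supp D then (if i \<in> T then z else y) else (if i \<in> T then w else x))"
proof -
  let ?m = "\<lambda>(i, j). w ^ (card T - j) * z ^ j * x ^ (CARD('n) - card T - i) * y ^ i"
  let ?g = "\<lambda>D. (wt (- T) D, wt T D)"
  let ?I = "{0..CARD('n) - card T} \<times> {0..card T}"
  have cT: "card (- T) = CARD('n) - card T"
    by (simp add: Compl_eq_Diff_UNIV card_Diff_subset)
  have bound: "wt S D \<le> card S" for S and D :: "('a ^ 'n) set"
    unfolding wt_def by (intro card_mono) auto
  have diff: "card (S - Supp D) = card S - wt S D" for S and D :: "('a ^ 'n) set"
    unfolding wt_def by (subst Int_commute) (simp add: card_Diff_subset_Int)
  have monomial: "?m (?g D) = (\<Prod>i\<in>UNIV.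
      if i \<in> Supp D then (if i \<in> T then z else y) else (if i \<in> T then w else x))"
    (is "_ = prod ?p UNIV") for D :: "('a ^ 'n) set"
  proof -
    have part: "(\<Prod>i\<in>S. if i \<in> Supp D then b else a) = b ^ wt S D * a ^ (card S - wt S D)"
      for S and a b :: 'b
    proof -
      have "(\<Prod>i\<in>S. if i \<in> Supp D then b else a)
          = (\<Prod>i\<in>S \<inter> Supp D. b) * (\<Prod>i\<in>S - Supp D. a)"
        by (subst prod.If_cases) (auto simp: Diff_eq)
      then show ?thesis
        by (simp add: diff) (simp add: wt_def Int_commute)
    qed
    have "prod ?p UNIV = prod ?p T * prod ?p (- T)"
      by (subst prod.union_disjoint[symmetric]) (auto simp: Compl_partition)
    also have "prod ?p T = (\<Prod>i\<in>T. if i \<in> Supp D then z else w)"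
      by (intro prod.cong) auto
    also have "prod ?p (- T) = (\<Prod>i\<in>- T. if i \<in> Supp D then y else x)"
      by (intro prod.cong) auto
    finally show ?thesis
      by (simp add: part cT mult_ac)
  qed
  have "higher_jacobi r C T w z x y = (\<Sum>p\<in>?I. \<Sum>D\<in>{D \<in> subcodes r C. ?g D = p}. ?m (?g D))"
    unfolding higher_jacobi_def sum.cartesian_product
    by (intro sum.cong refl) (auto simp: jacobi_coeff_def mult_ac)
  also have "\<dots> = (\<Sum>D\<in>subcodes r C. ?m (?g D))"
    by (rule sum.group) (use bound[of "- T"] bound[of T] in \<open>auto simp: cT\<close>)
  finally show ?thesis
    by (simp only: monomial)
qed

text \<open>For a coordinate outside the support write the factor \<open>a\<close> as \<open>(a - b) + b\<close>, for one inside as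
  \<open>0 + b\<close>. In the expanded product the set \<open>S\<close> of coordinates where the first summand is chosen must
  avoid the support, that is, the subcode must lie in the code shortened at \<open>S\<close>.\<close>
lemma higher_jacobi_eq_sum_shortened:
  fixes C :: "('a::{field,finite} ^ 'n::finite) set" and w z x y :: "'b::comm_ring_1"
  shows "higher_jacobi r C T w z x y
    = (\<Sum>S\<in>UNIV. (\<Prod>i\<in>S. if i \<in> T then w - z else x - y)
        * (\<Prod>i\<in>- S. if i \<in> T then z else y) * of_nat (card (subcodes r (shortened S C))))"
proof -
  let ?a = "\<lambda>i. if i \<in> T then w - z else x - y" and ?b = "\<lambda>i. if i \<in> T then z else y"
  have "(\<Prod>i\<in>UNIV. if i \<in> Supp D then ?b i else (if i \<in> T then w else x))
      = (\<Sum>S\<in>UNIV. if S \<subseteq> - Supp D then prod ?a S * prod ?b (- S) else 0)"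
    for D :: "('a ^ 'n) set"
  proof -
    have "(\<Prod>i\<in>UNIV. if i \<in> Supp D then ?b i else (if i \<in> T then w else x))
        = (\<Prod>i\<in>UNIV. (if i \<in> Supp D then 0 else ?a i) + ?b i)"
      by (intro prod.cong) auto
    also have "\<dots> = (\<Sum>S\<in>UNIV. (\<Prod>i\<in>S. if i \<in> Supp D then 0 else ?a i) * prod ?b (- S))"
      by (simp add: prod_add Compl_eq_Diff_UNIV)
    also have "\<dots> = (\<Sum>S\<in>UNIV. if S \<subseteq> - Supp D then prod ?a S * prod ?b (- S) else 0)"
    proof (intro sum.cong refl)
      fix S :: "'n set"
      show "(\<Prod>i\<in>S. if i \<in> Supp D then 0 else ?a i) * prod ?b (- S)
          = (if S \<subseteq> - Supp D then prod ?a S * prod ?b (- S) else 0)"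
      proof (cases "S \<subseteq> - Supp D")
        case True
        then have "(\<Prod>i\<in>S. if i \<in> Supp D then 0 else ?a i) = prod ?a S"
          by (intro prod.cong) auto
        with True show ?thesis
          by simp
      next
        case False
        then have "(\<Prod>i\<in>S. if i \<in> Supp D then 0 else ?a i) = 0"
          by (intro prod_zero) auto
        with False show ?thesis
          by simp
      qed
    qed
    finally show ?thesis .
  qed
  then have "higher_jacobi r C T w z x y = (\<Sum>D\<in>subcodes r C. \<Sum>S\<in>UNIV.
      if S \<subseteq> - Supp D then prod ?a S * prod ?b (- S) else 0)"
    by (simp only: higher_jacobi_eq_sum_subcodes)
  also have "\<dots> = (\<Sum>S\<in>UNIV. \<Sum>D\<in>subcodes r C.
      if S \<subseteq> - Supp D then prod ?a S * prod ?b (- S) else 0)"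
    by (rule sum.swap)
  also have "\<dots> = (\<Sum>S\<in>UNIV. prod ?a S * prod ?b (- S) * of_nat (card (subcodes r (shortened S C))))"
  proof (intro sum.cong refl)
    fix S :: "'n set"
    have "{D \<in> subcodes r C. S \<subseteq> - Supp D} = subcodes r (shortened S C)"
      by (fastforce simp: subcodes_def shortened_def Supp_def)
    then show "(\<Sum>D\<in>subcodes r C. if S \<subseteq> - Supp D then prod ?a S * prod ?b (- S) else 0)
        = prod ?a S * prod ?b (- S) * of_nat (card (subcodes r (shortened S C)))"
      by (simp add: sum.inter_filter[symmetric] mult.commute)
  qed
  finally show ?thesis .
qed

lemma const_poly_add: "const_poly (a + b) = const_poly a + const_poly b"
  by (simp add: const_poly_def single_add)

lemma const_poly_diff: "const_poly (a - b) = const_poly a - const_poly b"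
  by (simp add: const_poly_def single_diff)

lemma const_poly_mult: "const_poly (a * b) = const_poly a * const_poly b"
  by (simp add: const_poly_def mult_single)

lemma const_poly_1: "const_poly 1 = 1"
  by (simp add: const_poly_def)

lemma const_poly_power: "const_poly (a ^ n) = const_poly a ^ n"
  by (induction n) (simp_all add: const_poly_1 const_poly_mult)

lemma const_poly_of_nat: "const_poly (of_nat n) = of_nat n"
  by (simp add: const_poly_def)

lemma const_poly_sum: "const_poly (sum f A) = (\<Sum>i\<in>A. const_poly (f i))"
  by (induction A rule: infinite_finite_induct)
    (simp_all add: const_poly_add, simp_all add: const_poly_def)

text \<open>Under the substitution the differences become \<open>w + (Q - 1) z - (w - z) = Q z\<close> and likewise \<open>Q y\<close>, so
  the expansion over \<open>S\<close> turns into the original one after replacing \<open>S\<close> by its complement.\<close>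
lemma higher_jacobi_macwilliams_arguments:
  fixes C :: "('a::{field,finite} ^ 'n::finite) set" and w z x y :: rat_poly4
  assumes C: "vec.subspace C"
  shows "higher_jacobi l C T (w + const_poly (Q - 1) * z) (w - z) (x + const_poly (Q - 1) * y) (x - y)
    = (\<Sum>S\<in>UNIV. (\<Prod>i\<in>S. if i \<in> T then w - z else x - y) * (\<Prod>i\<in>- S. if i \<in> T then z else y)
        * const_poly (Q ^ card (- S)
            * q_binomial (of_nat CARD('a)) (vec.dim (shortened (- S) C)) l))"
    (is "?lhs = _")
proof -
  let ?a = "\<lambda>i. if i \<in> T then w - z else x - y" and ?b = "\<lambda>i. if i \<in> T then z else y"
  let ?N = "\<lambda>S. of_nat (card (subcodes l (shortened S C)))"
  have eq: "w + const_poly (Q - 1) * z - (w - z) = const_poly Q * z"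
    "x + const_poly (Q - 1) * y - (x - y) = const_poly Q * y"
    by (simp_all add: const_poly_diff const_poly_1 algebra_simps)
  have "?lhs = (\<Sum>S\<in>UNIV. (\<Prod>i\<in>S. const_poly Q * ?b i) * prod ?a (- S) * ?N S)"
    unfolding higher_jacobi_eq_sum_shortened eq
    by (intro sum.cong prod.cong refl arg_cong2[where f = "(*)"]) auto
  also have "\<dots> = (\<Sum>S\<in>UNIV. (\<Prod>i\<in>- S. const_poly Q * ?b i) * prod ?a S * ?N (- S))"
    by (rule sum.reindex_bij_witness[of _ uminus uminus]) auto
  also have "\<dots> = (\<Sum>S\<in>UNIV. prod ?a S * prod ?b (- S) * const_poly (Q ^ card (- S)
      * q_binomial (of_nat CARD('a)) (vec.dim (shortened (- S) C)) l))"
    by (simp add: prod.distrib const_poly_mult const_poly_power const_poly_of_nat mult_ac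
        flip: card_subcodes[OF subspace_shortened[OF C]])
  finally show ?thesis .
qed

theorem theorem3p1:
  fixes C :: "('a::{field,finite} ^ 'n::finite) set"
    and T :: "'n set"
    and k r :: nat
    and q :: rat
    and w z x y :: rat_poly4
  assumes "linear_code C k"
    and "q = of_nat CARD('a)"
    and "w = indeterminate Ind_w"
    and "z = indeterminate Ind_z"
    and "x = indeterminate Ind_x"
    and "y = indeterminate Ind_y"
  shows "higher_jacobi r (dual_code C) T w z x y =
    (\<Sum>j = 0..r. \<Sum>l = 0..j.
       const_poly
         ((- 1) ^ (r - j)
           * (q powi (int ((r - j) choose 2) - int (j * (r - j)) - int (l * (j - l)) - int (j * k))
               / (q_order q (r - j) * q_order q (j - l))))
       * higher_jacobi l C T
           (w + const_poly (q ^ j - 1) * z) (w - z)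
           (x + const_poly (q ^ j - 1) * y) (x - y))"
proof -
  have C: "vec.subspace C" and k: "vec.dim C = k"
    using assms(1) by (simp_all add: linear_code_def)
  have q1: "1 < q"
    unfolding assms(2) by (rule card_field_gt_1)
  let ?c = "\<lambda>j l. (- 1) ^ (r - j)
    * (q powi (int ((r - j) choose 2) - int (j * (r - j)) - int (l * (j - l)) - int (j * k))
        / (q_order q (r - j) * q_order q (j - l)))"
  let ?M = "\<lambda>S. (\<Prod>i\<in>S. if i \<in> T then w - z else x - y) * (\<Prod>i\<in>- S. if i \<in> T then z else y)"
  let ?d = "\<lambda>S. vec.dim (shortened (- S) C)"
  \<comment> \<open>The two expansions agree product by product: this compares the coefficients at \<open>S\<close>.\<close>
  have count: "of_nat (card (subcodes r (shortened S (dual_code C))))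
      = (\<Sum>j = 0..r. \<Sum>l = 0..j. ?c j l * (q ^ j) ^ card (- S) * q_binomial q (?d S) l)" for S
    unfolding card_subcodes[OF subspace_shortened[OF subspace_dual_code]] assms(2)[symmetric]
    using dim_shortened_dual[OF C, of S]
    by (intro q_binomial_dual_transform[OF q1]) (simp add: k)
  have "higher_jacobi r (dual_code C) T w z x y
      = (\<Sum>S\<in>UNIV. ?M S * const_poly (of_nat (card (subcodes r (shortened S (dual_code C))))))"
    by (simp only: higher_jacobi_eq_sum_shortened const_poly_of_nat)
  also have "\<dots> = (\<Sum>S\<in>UNIV. \<Sum>j = 0..r. \<Sum>l = 0..j.
      const_poly (?c j l) * (?M S * const_poly ((q ^ j) ^ card (- S) * q_binomial q (?d S) l)))"
    unfolding count const_poly_sum sum_distrib_left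
    by (simp only: const_poly_mult mult_ac)
  also have "\<dots> = (\<Sum>j = 0..r. \<Sum>l = 0..j. const_poly (?c j l)
      * (\<Sum>S\<in>UNIV. ?M S * const_poly ((q ^ j) ^ card (- S) * q_binomial q (?d S) l)))"
    unfolding sum_distrib_left
    by (subst sum.swap) (intro sum.cong refl sum.swap)
  finally show ?thesis
    unfolding higher_jacobi_macwilliams_arguments[OF C] assms(2)[symmetric] .
qed

end
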